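(* Let $f,g:\mathbb{R}^n\to\mathbb{R}\cup\{\infty\}$ be proper, lower semicontinuous, convex functions, and set $h:=f+g$. Assume that $\mathrm{dom}\,h$ is unbounded and that $$\partial^\infty f(\infty)\cap\bigl(-\partial^\infty g(\infty)\bigr)=\{0\}.$$ Then $$\partial h(\infty)\subset\partial f(\infty)+\partial g(\infty).$$
   Context: For $\varphi:\mathbb{R}^n\to\mathbb{R}\cup\{\infty\}$: $\mathrm{dom}\,\varphi=\{x\mid\varphi(x)<\infty\}$; $\varphi$ is proper if $\mathrm{dom}\,\varphi\ne\emptyset$; $\mathrm{epi}\,\varphi=\{(x,r)\in\mathbb{R}^n\times\mathbb{R}\mid r\ge\varphi(x)\}$. For $\varphi$ proper, lower semicontinuous, convex with $\mathrm{dom}\,\varphi$ unbounded, and $I=\{1,\dots,n\}$ selecting the $x$-coordinates in $\mathbb{R}^n\times\mathbb{R}$: $T(\infty_I;\mathrm{epi}\,\varphi)$ is the set of $(w,\rho)$ such that for all sequences $(x_k,r_k)\in\mathrm{epi}\,\varphi$ with $\|x_k\|\to\infty$ and all $t_k>0$ with $t_k\to0$ there exist $(w_k,\rho_k)\to(w,\rho)$ with $(x_k,r_k)+t_k(w_k,\rho_k)\in\mathrm{epi}\,\varphi$ for all $k$. $N(\infty_I;\mathrm{epi}\,\varphi)=\{(u,c)\mid\langle u,w\rangle+c\rho\le0\ \forall(w,\rho)\in T(\infty_I;\mathrm{epi}\,\varphi)\}$. Then $\partial\varphi(\infty)=\{u\mid(u,-1)\in N(\infty_I;\mathrm{epi}\,\varphi)\}$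 and $\partial^\infty\varphi(\infty)=\{u\mid(u,0)\in N(\infty_I;\mathrm{epi}\,\varphi)\}$. *)

theory Defs
  imports "HOL-Analysis.Analysis" "HOL-Library.Set_Algebras"
begin

text \<open>
  Functions into \<open>\<real> \<union> {\<infinity>}\<close> are rendered as functions into \<^typ>\<open>ereal\<close> that never take the value
  \<open>-\<infinity>\<close>; the latter is a separate hypothesis, not a part of the definitions below.
\<close>

definition domain_of :: "('a \<Rightarrow> ereal) \<Rightarrow> 'a set" where
  "domain_of \<phi> = {x. \<phi> x < \<infinity>}"

definition proper_fun :: "('a \<Rightarrow> ereal) \<Rightarrow> bool" where
  "proper_fun \<phi> \<longleftrightarrow> domain_of \<phi> \<noteq> {}"

definition epi :: "('a \<Rightarrow> ereal) \<Rightarrow> ('a \<times> real) set" where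
  "epi \<phi> = {(x, r). \<phi> x \<le> ereal r}"

definition lsc_fun :: "('a::topological_space \<Rightarrow> ereal) \<Rightarrow> bool" where
  "lsc_fun \<phi> \<longleftrightarrow> (\<forall>x. \<phi> x \<le> Liminf (nhds x) \<phi>)"

text \<open>
  The library's \<^const>\<open>convex_on\<close> only covers real-valued functions.
\<close>

definition convex_fun :: "('a::real_vector \<Rightarrow> ereal) \<Rightarrow> bool" where
  "convex_fun \<phi> \<longleftrightarrow>
     (\<forall>x y. \<forall>t::real. 0 < t \<and> t < 1 \<longrightarrow>
        \<phi> ((1 - t) *\<^sub>R x + t *\<^sub>R y) \<le> ereal (1 - t) * \<phi> x + ereal t * \<phi> y)"

text \<open>
  Tangent and normal cones of a subset of \<open>\<real>\<^sup>n \<times> \<real>\<close> at infinity with respect to the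
  \<open>x\<close>-coordinates: only the first component of the base points is required to diverge.
\<close>

definition tangent_inf :: "('a::real_normed_vector \<times> real) set \<Rightarrow> ('a \<times> real) set" where
  "tangent_inf \<Omega> = {(w, \<rho>).
     \<forall>(x :: nat \<Rightarrow> 'a) (r :: nat \<Rightarrow> real) (t :: nat \<Rightarrow> real).
       (\<forall>k. (x k, r k) \<in> \<Omega>) \<and> filterlim (\<lambda>k. norm (x k)) at_top sequentially \<and>
       (\<forall>k. 0 < t k) \<and> t \<longlonglongrightarrow> 0 \<longrightarrow>
       (\<exists>(w' :: nat \<Rightarrow> 'a) (\<rho>' :: nat \<Rightarrow> real).
          (\<lambda>k. (w' k, \<rho>' k)) \<longlonglongrightarrow> (w, \<rho>) \<and>
          (\<forall>k. (x k, r k) + t k *\<^sub>R (w' k, \<rho>' k) \<in> \<Omega>))}"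

definition normal_inf :: "('a::real_inner \<times> real) set \<Rightarrow> ('a \<times> real) set" where
  "normal_inf \<Omega> = {(u, c). \<forall>(w, \<rho>) \<in> tangent_inf \<Omega>. u \<bullet> w + c * \<rho> \<le> 0}"

definition subdiff_inf :: "('a::real_inner \<Rightarrow> ereal) \<Rightarrow> 'a set" where
  "subdiff_inf \<phi> = {u. (u, -1) \<in> normal_inf (epi \<phi>)}"

definition singular_subdiff_inf :: "('a::real_inner \<Rightarrow> ereal) \<Rightarrow> 'a set" where
  "singular_subdiff_inf \<phi> = {u. (u, 0) \<in> normal_inf (epi \<phi>)}"

end

theory Submission
  imports Defs
begin

text \<open>
  Let \<open>T\<^sub>f\<close> and \<open>T\<^sub>g\<close> be the tangent cones at infinity of the two epigraphs, and \<open>D\<^sub>f\<close>, \<open>D\<^sub>g\<close> their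
  projections to the \<open>x\<close>-space. By separation, the qualification condition says that
  \<open>D\<^sub>f - D\<^sub>g\<close> is the whole space. Hence two tangents \<open>(w, \<rho>\<^sub>1) \<in> T\<^sub>f\<close> and \<open>(w, \<rho>\<^sub>2) \<in> T\<^sub>g\<close> add up to a
  tangent \<open>(w, \<rho>\<^sub>1 + \<rho>\<^sub>2)\<close> of \<open>epi h\<close>: the approximating directions for \<open>f\<close> and \<open>g\<close> differ by a
  vanishing error, which a convex combination with a vanishing weight on bounded directions
  removes. So \<open>u \<in> \<partial>h(\<infinity>)\<close> satisfies \<open>\<langle>u, w\<rangle> \<le> \<rho>\<^sub>1 + \<rho>\<^sub>2\<close> for all such pairs, and separating
  \<open>(0, -1)\<close> from the cone of all \<open>(w\<^sub>1 - w\<^sub>2, \<rho>\<^sub>1 + \<rho>\<^sub>2 - \<langle>u, w\<^sub>2\<rangle>)\<close> splits \<open>u\<close>; the separating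
  hyperplane is not vertical, again by the qualification condition.
\<close>

section \<open>Separation from convex cones and a criterion for containing a ball\<close>

text \<open>A functional bounded below on a cone is nonnegative there, by scaling, and the bound is
  at most 0 because the cone contains 0. The cone may fail to be closed, so the inequality at
  \<open>z\<close> is weak.\<close>

lemma convex_cone_separation:
  fixes S :: "'a::euclidean_space set"
  assumes "convex_cone S" "z \<notin> S"
  obtains a where "a \<noteq> 0" "a \<bullet> z \<le> 0" "\<And>x. x \<in> S \<Longrightarrow> 0 \<le> a \<bullet> x"
proof -
  obtain a b where ab: "a \<noteq> 0" "a \<bullet> z \<le> b" "\<And>x. x \<in> S \<Longrightarrow> b \<le> a \<bullet> x"
    using separating_hyperplane_sets[of "{z}" S] assms by (auto simp: convex_cone_def)
  have b0: "b \<le> 0" using ab(3)[OF convex_cone_contains_0[OF assms(1)]] by simp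
  have "0 \<le> a \<bullet> x" if "x \<in> S" for x
  proof (rule ccontr)
    assume neg: "\<not> 0 \<le> a \<bullet> x"
    \<comment> \<open>Chosen so that \<open>a\<close> takes the value \<open>b - 1\<close> at the
      multiple \<open>c *\<^sub>R x\<close>; \<open>c\<close> is nonnegative as a quotient of two
      negative numbers.\<close>
    define c where "c = (b - 1) / (a \<bullet> x)"
    have "c \<ge> 0" using neg b0 by (simp add: c_def divide_nonpos_nonpos)
    then have "b \<le> a \<bullet> (c *\<^sub>R x)"
      using ab(3) convex_cone_scaleR[OF assms(1)] that by blast
    also have "\<dots> = b - 1" using neg by (simp add: c_def)
    finally show False by simp
  qed
  then show thesis using that ab b0 by fastforce
qed

text \<open>Pulls the separating inequality back to \<open>S\<close>; below, \<open>S\<close> is a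
  product of two tangent cones and \<open>L\<close> combines a pair of tangents.\<close>

lemma convex_cone_image_separation:
  fixes L :: "'a::real_vector \<Rightarrow> 'b::euclidean_space"
  assumes "linear L" "convex_cone S" "z \<notin> L ` S"
  obtains a where "a \<noteq> 0" "a \<bullet> z \<le> 0" "\<forall>x\<in>S. 0 \<le> a \<bullet> L x"
proof (rule convex_cone_separation[OF _ assms(3)])
  show "convex_cone (L ` S)" using assms by (simp add: convex_cone_linear_image)
  fix a assume "a \<noteq> 0" "a \<bullet> z \<le> 0" "\<And>x. x \<in> L ` S \<Longrightarrow> 0 \<le> a \<bullet> x"
  then show thesis by (intro that[of a]) auto
qed

text \<open>A functional \<open>a\<close> separating a point of the ball from \<open>S\<close> has a
  coordinate of modulus at least \<open>norm a / DIM('a)\<close>. Near the basis vector signed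
  against that coordinate, \<open>S\<close> has a point where \<open>a\<close> is too small, since
  \<open>\<epsilon>\<close> is below \<open>1 / (2 * DIM('a))\<close>. Thus finitely many
  approximate memberships yield a whole ball.\<close>

lemma cball_subset_convex_near_signed_Basis:
  fixes S :: "'a::euclidean_space set"
  assumes "convex S" and \<epsilon>: "\<epsilon> < 1 / (2 * DIM('a))"
    and near: "\<And>c. c \<in> Basis \<union> uminus ` Basis \<Longrightarrow> \<exists>x\<in>S. norm (x - c) \<le> \<epsilon>"
  shows "cball 0 \<epsilon> \<subseteq> S"
proof (rule subsetI, rule ccontr)
  fix y assume y: "y \<in> cball 0 \<epsilon>" "y \<notin> S"
  have "S \<noteq> {}" using near[of "SOME b. b \<in> Basis"] SOME_Basis by blast
  then obtain a \<beta> where a: "a \<noteq> 0" "a \<bullet> y \<le> \<beta>" "\<And>x. x \<in> S \<Longrightarrow> \<beta> \<le> a \<bullet> x"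
    using separating_hyperplane_sets[of "{y}" S] assms(1) y(2) by auto
  have "\<exists>b\<in>Basis. norm a \<le> DIM('a) * \<bar>a \<bullet> b\<bar>"
  proof (rule ccontr)
    assume "\<not> ?thesis"
    then have "(\<Sum>b\<in>Basis. \<bar>a \<bullet> b\<bar>) < (\<Sum>b\<in>(Basis::'a set). norm a / DIM('a))"
      by (intro sum_strict_mono) (auto simp: field_simps not_le)
    then show False using norm_le_l1[of a] by simp
  qed
  then obtain b where b: "b \<in> Basis" "norm a \<le> DIM('a) * \<bar>a \<bullet> b\<bar>" by blast
  define c where "c = (if a \<bullet> b \<ge> 0 then - b else b)"
  have c: "c \<in> Basis \<union> uminus ` Basis" "a \<bullet> c = - \<bar>a \<bullet> b\<bar>"
    using b(1) by (auto simp: c_def)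
  obtain x where x: "x \<in> S" "norm (x - c) \<le> \<epsilon>" using near[OF c(1)] by blast
  have le: "\<bar>a \<bullet> v\<bar> \<le> norm a * \<epsilon>" if "norm v \<le> \<epsilon>" for v
    using Cauchy_Schwarz_ineq2[of a v] mult_left_mono[OF that norm_ge_zero[of a]] by linarith
  have "- (norm a * \<epsilon>) \<le> a \<bullet> y" using le[of y] y(1) by simp
  also have "\<dots> \<le> a \<bullet> x" using a x(1) by force
  also have "\<dots> = a \<bullet> (x - c) - \<bar>a \<bullet> b\<bar>" using c(2) by (simp add: inner_diff_right)
  also have "\<dots> \<le> norm a * \<epsilon> - norm a / DIM('a)"
  proof -
    have "norm a / DIM('a) \<le> \<bar>a \<bullet> b\<bar>"
      using b(2) by (simp add: pos_divide_le_eq mult.commute)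
    then show ?thesis using le[OF x(2)] by linarith
  qed
  finally have "norm a * (1 / DIM('a)) \<le> norm a * (2 * \<epsilon>)" by (simp add: algebra_simps)
  then have "1 / DIM('a) \<le> 2 * \<epsilon>" using a(1) by (meson mult_le_cancel_left_pos zero_less_norm_iff)
  then show False using \<epsilon> by simp
qed

section \<open>The tangent cone at infinity as a convex cone\<close>

text \<open>Asking for membership only eventually changes nothing, because a limit ignores finitely
  many terms. In this form several approximating sequences can be combined with limit
  arguments.\<close>

lemma tangent_inf_iff:
  "v \<in> tangent_inf \<Omega> \<longleftrightarrow>
    (\<forall>z t. (\<forall>k. z k \<in> \<Omega>) \<and> filterlim (\<lambda>k. norm (fst (z k))) at_top sequentially \<and>
       (\<forall>k. 0 < t k) \<and> t \<longlonglongrightarrow> 0 \<longrightarrow>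
       (\<exists>v'. v' \<longlonglongrightarrow> v \<and> (\<forall>\<^sub>F k in sequentially. z k + t k *\<^sub>R v' k \<in> \<Omega>)))"
    (is "_ \<longleftrightarrow> (\<forall>z t. ?A z t \<longrightarrow> ?E z t)")
proof
  assume L: "v \<in> tangent_inf \<Omega>"
  show "\<forall>z t. ?A z t \<longrightarrow> ?E z t"
  proof (intro allI impI)
    fix z t assume A: "?A z t"
    obtain w \<rho> where v: "v = (w, \<rho>)" by fastforce
    have *: "(\<forall>k. (fst (z k), snd (z k)) \<in> \<Omega>) \<and> filterlim (\<lambda>k. norm (fst (z k))) at_top sequentially \<and>
       (\<forall>k. 0 < t k) \<and> t \<longlonglongrightarrow> 0" using A by simp
    from L have "\<exists>w' \<rho>'. (\<lambda>k. (w' k, \<rho>' k)) \<longlonglongrightarrow> (w, \<rho>) \<and>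
       (\<forall>k. (fst (z k), snd (z k)) + t k *\<^sub>R (w' k, \<rho>' k) \<in> \<Omega>)"
      unfolding v tangent_inf_def mem_Collect_eq prod.case
      using * by (elim allE impE)
    then obtain w' \<rho>' where "(\<lambda>k. (w' k, \<rho>' k)) \<longlonglongrightarrow> (w, \<rho>)"
       "\<And>k. z k + t k *\<^sub>R (w' k, \<rho>' k) \<in> \<Omega>" by auto
    then show "?E z t" unfolding v by (intro exI[of _ "\<lambda>k. (w' k, \<rho>' k)"]) simp
  qed
next
  assume R: "\<forall>z t. ?A z t \<longrightarrow> ?E z t"
  obtain w \<rho> where v: "v = (w, \<rho>)" by fastforce
  show "v \<in> tangent_inf \<Omega>"
    unfolding v tangent_inf_def mem_Collect_eq prod.case
  proof (intro allI impI)
    fix x r t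
    assume A: "(\<forall>k. (x k, r k) \<in> \<Omega>) \<and> filterlim (\<lambda>k. norm (x k)) at_top sequentially \<and>
       (\<forall>k. 0 < t k) \<and> t \<longlonglongrightarrow> (0::real)"
    then obtain v' where v': "v' \<longlonglongrightarrow> v"
        "\<forall>\<^sub>F k in sequentially. (x k, r k) + t k *\<^sub>R v' k \<in> \<Omega>"
      using R[rule_format, of "\<lambda>k. (x k, r k)" t] by auto
    \<comment> \<open>The default direction 0 is always admissible, since the base point itself lies
      in \<open>\<Omega>\<close>.\<close>
    define v'' where "v'' k = (if (x k, r k) + t k *\<^sub>R v' k \<in> \<Omega> then v' k else 0)" for k
    have "v'' \<longlonglongrightarrow> v"
      using v'(1) by (rule Lim_transform_eventually)
        (use v'(2) in \<open>auto elim!: eventually_mono simp: v''_def\<close>)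
    moreover have "(x k, r k) + t k *\<^sub>R v'' k \<in> \<Omega>" for k
      using A by (auto simp: v''_def)
    ultimately show "\<exists>w' \<rho>'. (\<lambda>k. (w' k, \<rho>' k)) \<longlonglongrightarrow> (w, \<rho>) \<and>
          (\<forall>k. (x k, r k) + t k *\<^sub>R (w' k, \<rho>' k) \<in> \<Omega>)"
      unfolding v by (intro exI[of _ "\<lambda>k. fst (v'' k)"] exI[of _ "\<lambda>k. snd (v'' k)"]) simp
  qed
qed

lemma tangent_infD:
  assumes "v \<in> tangent_inf \<Omega>" "\<And>k. z k \<in> \<Omega>"
    "filterlim (\<lambda>k. norm (fst (z k))) at_top sequentially" "\<And>k. 0 < t k" "t \<longlonglongrightarrow> 0"
  obtains v' where "v' \<longlonglongrightarrow> v" "\<forall>\<^sub>F k in sequentially. z k + t k *\<^sub>R v' k \<in> \<Omega>"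
  using assms unfolding tangent_inf_iff by blast

lemma tangent_infI:
  assumes "\<And>z t. \<lbrakk>\<And>k. z k \<in> \<Omega>; filterlim (\<lambda>k. norm (fst (z k))) at_top sequentially;
      \<And>k. 0 < t k; t \<longlonglongrightarrow> 0\<rbrakk>
    \<Longrightarrow> \<exists>v'. v' \<longlonglongrightarrow> v \<and> (\<forall>\<^sub>F k in sequentially. z k + t k *\<^sub>R v' k \<in> \<Omega>)"
  shows "v \<in> tangent_inf \<Omega>"
  using assms unfolding tangent_inf_iff by blast

lemma zero_in_tangent_inf: "0 \<in> tangent_inf \<Omega>"
  by (rule tangent_infI, rule exI[of _ "\<lambda>_. 0"]) simp

text \<open>A positive factor \<open>c\<close> is absorbed into the step sizes, \<open>t k\<close>
  becoming \<open>t k * c\<close>. The factor 0 is treated apart because step sizes must stay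
  positive.\<close>

lemma conic_tangent_inf: "conic (tangent_inf \<Omega>)"
  unfolding conic_def
proof (intro allI impI)
  fix v and c :: real
  assume v: "v \<in> tangent_inf \<Omega>" and "0 \<le> c"
  show "c *\<^sub>R v \<in> tangent_inf \<Omega>"
  proof (cases "c = 0")
    case True
    then show ?thesis by (simp add: zero_in_tangent_inf)
  next
    case False
    with \<open>0 \<le> c\<close> have c: "c > 0" by simp
    show ?thesis
    proof (rule tangent_infI)
      fix z :: "nat \<Rightarrow> 'a \<times> real" and t :: "nat \<Rightarrow> real"
      assume z: "\<And>k. z k \<in> \<Omega>" "filterlim (\<lambda>k. norm (fst (z k))) at_top sequentially"
        and t: "\<And>k. 0 < t k" "t \<longlonglongrightarrow> 0"
      have "(\<lambda>k. t k * c) \<longlonglongrightarrow> 0" using tendsto_mult_left_zero[OF t(2)] .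
      then obtain v' where v': "v' \<longlonglongrightarrow> v"
          "\<forall>\<^sub>F k in sequentially. z k + (t k * c) *\<^sub>R v' k \<in> \<Omega>"
        using tangent_infD[OF v z, of "\<lambda>k. t k * c"] t(1) c by auto
      then show "\<exists>v'. v' \<longlonglongrightarrow> c *\<^sub>R v \<and> (\<forall>\<^sub>F k in sequentially. z k + t k *\<^sub>R v' k \<in> \<Omega>)"
        by (intro exI[of _ "\<lambda>k. c *\<^sub>R v' k"]) (auto intro!: tendsto_intros)
    qed
  qed
qed

lemma convex_step:
  fixes z :: "'a::real_vector"
  assumes "convex \<Omega>" "z + t *\<^sub>R v \<in> \<Omega>" "z + t *\<^sub>R w \<in> \<Omega>" "0 \<le> a" "0 \<le> b" "a + b = 1"
  shows "z + t *\<^sub>R (a *\<^sub>R v + b *\<^sub>R w) \<in> \<Omega>"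
proof -
  have "a *\<^sub>R (z + t *\<^sub>R v) + b *\<^sub>R (z + t *\<^sub>R w) = (a + b) *\<^sub>R z + t *\<^sub>R (a *\<^sub>R v + b *\<^sub>R w)"
    by (simp add: algebra_simps)
  then show ?thesis using convexD[OF assms(1-3) assms(4-6)] assms(6) by simp
qed

text \<open>The set is a ball intersected with an affine preimage of \<open>\<Omega>\<close>. The
  norm bound later makes corrections with vanishing weight tend to 0.\<close>

lemma convex_bounded_steps:
  fixes z :: "'a::real_normed_vector"
  assumes "convex \<Omega>"
  shows "convex {p. z + t *\<^sub>R p \<in> \<Omega> \<and> norm p \<le> M}"
proof -
  have "convex {p. z + t *\<^sub>R p \<in> \<Omega>}"
    by (rule convexI) (simp add: convex_step[OF assms])
  from convex_Int[OF this convex_cball[of 0 M]] show ?thesis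
    by (simp add: Int_def)
qed

lemma convex_tangent_inf:
  assumes "convex \<Omega>"
  shows "convex (tangent_inf \<Omega>)"
proof (rule convexI, rule tangent_infI)
  fix v w and a b :: real and z :: "nat \<Rightarrow> 'a \<times> real" and t :: "nat \<Rightarrow> real"
  assume v: "v \<in> tangent_inf \<Omega>" and w: "w \<in> tangent_inf \<Omega>" and ab: "0 \<le> a" "0 \<le> b" "a + b = 1"
    and z: "\<And>k. z k \<in> \<Omega>" "filterlim (\<lambda>k. norm (fst (z k))) at_top sequentially"
    and t: "\<And>k. 0 < t k" "t \<longlonglongrightarrow> 0"
  obtain v' where v': "v' \<longlonglongrightarrow> v" "\<forall>\<^sub>F k in sequentially. z k + t k *\<^sub>R v' k \<in> \<Omega>"
    using tangent_infD[OF v z t] .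
  obtain w' where w': "w' \<longlonglongrightarrow> w" "\<forall>\<^sub>F k in sequentially. z k + t k *\<^sub>R w' k \<in> \<Omega>"
    using tangent_infD[OF w z t] .
  have "\<forall>\<^sub>F k in sequentially. z k + t k *\<^sub>R (a *\<^sub>R v' k + b *\<^sub>R w' k) \<in> \<Omega>"
    using v'(2) w'(2) by eventually_elim (rule convex_step[OF assms _ _ ab])
  then show "\<exists>v'. v' \<longlonglongrightarrow> a *\<^sub>R v + b *\<^sub>R w \<and> (\<forall>\<^sub>F k in sequentially. z k + t k *\<^sub>R v' k \<in> \<Omega>)"
    by (intro exI[of _ "\<lambda>k. a *\<^sub>R v' k + b *\<^sub>R w' k"]) (auto intro!: tendsto_intros v' w')
qed

section \<open>Epigraphs of convex functions and of sums\<close>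

lemma epi_iff: "(x, r) \<in> epi \<phi> \<longleftrightarrow> \<phi> x \<le> ereal r"
  by (simp add: epi_def)

lemma convex_epi:
  assumes "convex_fun \<phi>"
  shows "convex (epi \<phi>)"
  unfolding convex_alt
proof (intro ballI allI impI)
  fix p q and u :: real
  assume p: "p \<in> epi \<phi>" and q: "q \<in> epi \<phi>" and u: "0 \<le> u \<and> u \<le> 1"
  obtain x r y s where pq: "p = (x, r)" "q = (y, s)" by fastforce
  consider "u = 0" | "u = 1" | "0 < u" "u < 1" using u by linarith
  then show "(1 - u) *\<^sub>R p + u *\<^sub>R q \<in> epi \<phi>"
  proof cases
    case 3
    then have "\<phi> ((1 - u) *\<^sub>R x + u *\<^sub>R y) \<le> ereal (1 - u) * \<phi> x + ereal u * \<phi> y"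
      using assms by (simp add: convex_fun_def)
    also have "\<dots> \<le> ereal (1 - u) * ereal r + ereal u * ereal s"
      using p q 3 by (intro add_mono ereal_mult_left_mono) (auto simp: pq epi_iff)
    finally show ?thesis by (simp add: pq epi_iff)
  qed (use p q in auto)
qed

lemma epi_add:
  assumes "(x, r) \<in> epi \<phi>" "(x, s) \<in> epi \<psi>"
  shows "(x, r + s) \<in> epi (\<lambda>x. \<phi> x + \<psi> x)"
  using add_mono[of "\<phi> x" "ereal r" "\<psi> x" "ereal s"] assms by (simp add: epi_iff)

lemma epi_add_split:
  assumes "\<phi> x \<noteq> -\<infinity>" "\<psi> x \<noteq> -\<infinity>" "(x, r) \<in> epi (\<lambda>x. \<phi> x + \<psi> x)"
  obtains s where "(x, s) \<in> epi \<phi>" "(x, r - s) \<in> epi \<psi>"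
proof (rule that)
  \<comment> \<open>Neither value is \<open>-\<infinity>\<close> and the sum is at most a real
    number, so both values are finite and \<open>real_of_ereal\<close> is exact.\<close>
  show "(x, real_of_ereal (\<phi> x)) \<in> epi \<phi>" "(x, r - real_of_ereal (\<phi> x)) \<in> epi \<psi>"
    using assms by (cases "\<phi> x"; cases "\<psi> x"; simp add: epi_iff)+
qed

lemma convex_cone_tangent_inf_epi:
  "convex_fun \<phi> \<Longrightarrow> convex_cone (tangent_inf (epi \<phi>))"
  using zero_in_tangent_inf
  by (auto simp: convex_cone_def conic_tangent_inf convex_tangent_inf convex_epi)

section \<open>The qualification condition and tangents of a sum\<close>

text \<open>If \<open>z\<close> were missed, pairing each tangent with 0 in the separating
  inequality would put \<open>- a\<close> into the singular subdifferential of \<open>f\<close> and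
  \<open>a\<close> into that of \<open>g\<close>, with \<open>a\<close> nonzero.\<close>

lemma fst_tangent_inf_diff_eq_UNIV:
  fixes f g :: "'a::euclidean_space \<Rightarrow> ereal"
  assumes conv: "convex_fun f" "convex_fun g"
    and qc: "singular_subdiff_inf f \<inter> uminus ` singular_subdiff_inf g \<subseteq> {0}"
  obtains w1 \<rho>1 w2 \<rho>2 where "(w1, \<rho>1) \<in> tangent_inf (epi f)" "(w2, \<rho>2) \<in> tangent_inf (epi g)"
    "z = w1 - w2"
proof -
  let ?T = "tangent_inf (epi f) \<times> tangent_inf (epi g)"
  let ?L = "\<lambda>(v, w). fst v - fst w :: 'a"
  have lin: "linear ?L"
    by (auto intro!: linearI simp: algebra_simps)
  have "z \<in> ?L ` ?T"
  proof (rule ccontr)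
    assume "z \<notin> ?L ` ?T"
    then obtain a where a: "a \<noteq> 0" "\<forall>x\<in>?T. 0 \<le> a \<bullet> ?L x"
      by (rule convex_cone_image_separation
        [OF lin convex_cone_Times[OF conv[THEN convex_cone_tangent_inf_epi]]]) blast
    have a': "0 \<le> a \<bullet> (fst v - fst w)" if "v \<in> tangent_inf (epi f)" "w \<in> tangent_inf (epi g)" for v w
      using that bspec[OF a(2), of "(v, w)"] by simp
    have "- a \<in> singular_subdiff_inf f"
      using a'[OF _ zero_in_tangent_inf]
      by (auto simp: singular_subdiff_inf_def normal_inf_def)
    moreover have "a \<in> singular_subdiff_inf g"
      using a'[OF zero_in_tangent_inf]
      by (auto simp: singular_subdiff_inf_def normal_inf_def)
    ultimately show False using qc a(1) by force
  qed
  then show thesis using that by auto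
qed

lemma tangent_inf_epi_add:
  fixes f g :: "'a::euclidean_space \<Rightarrow> ereal"
  assumes conv: "convex_fun f" "convex_fun g" and inf: "\<And>x. f x \<noteq> -\<infinity>" "\<And>x. g x \<noteq> -\<infinity>"
    and qc: "singular_subdiff_inf f \<inter> uminus ` singular_subdiff_inf g \<subseteq> {0}"
    and v: "(w, \<rho>1) \<in> tangent_inf (epi f)" "(w, \<rho>2) \<in> tangent_inf (epi g)"
  shows "(w, \<rho>1 + \<rho>2) \<in> tangent_inf (epi (\<lambda>x. f x + g x))"
proof (rule tangent_infI)
  fix z :: "nat \<Rightarrow> 'a \<times> real" and t :: "nat \<Rightarrow> real"
  assume z: "\<And>k. z k \<in> epi (\<lambda>x. f x + g x)" "filterlim (\<lambda>k. norm (fst (z k))) at_top sequentially"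
    and t: "\<And>k. 0 < t k" "t \<longlonglongrightarrow> 0"
  have "\<exists>s. (fst (z k), s) \<in> epi f \<and> (fst (z k), snd (z k) - s) \<in> epi g" for k
  proof -
    have "(fst (z k), snd (z k)) \<in> epi (\<lambda>x. f x + g x)" using z(1) by simp
    then show ?thesis by (rule epi_add_split[rotated 2]) (use inf in blast)+
  qed
  then obtain s where s: "\<And>k. (fst (z k), s k) \<in> epi f" "\<And>k. (fst (z k), snd (z k) - s k) \<in> epi g"
    by metis
  \<comment> \<open>Both base points keep the \<open>x\<close>-part of \<open>z k\<close>, so they
    diverge as well and their heights add up to that of \<open>z k\<close>.\<close>
  define y1 where "y1 k = (fst (z k), s k)" for k
  define y2 where "y2 k = (fst (z k), snd (z k) - s k)" for k
  have y1: "\<And>k. y1 k \<in> epi f" "filterlim (\<lambda>k. norm (fst (y1 k))) at_top sequentially"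
    and y2: "\<And>k. y2 k \<in> epi g" "filterlim (\<lambda>k. norm (fst (y2 k))) at_top sequentially"
    using s z(2) by (auto simp: y1_def y2_def)
  obtain v1 where v1: "v1 \<longlonglongrightarrow> (w, \<rho>1)" "\<forall>\<^sub>F k in sequentially. y1 k + t k *\<^sub>R v1 k \<in> epi f"
    using tangent_infD[OF v(1) y1 t] .
  obtain v2 where v2: "v2 \<longlonglongrightarrow> (w, \<rho>2)" "\<forall>\<^sub>F k in sequentially. y2 k + t k *\<^sub>R v2 k \<in> epi g"
    using tangent_infD[OF v(2) y2 t] .
  define C :: "'a set" where "C = Basis \<union> uminus ` Basis"
  have "finite C" by (simp add: C_def)
  define \<epsilon> :: real where "\<epsilon> = 1 / (3 * DIM('a))"
  have \<epsilon>: "0 < \<epsilon>" "\<epsilon> < 1 / (2 * DIM('a))" by (auto simp: \<epsilon>_def field_simps)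

  \<comment> \<open>Write \<open>c\<close> as a difference of tangent \<open>x\<close>-parts. The
    approximating directions converge, so they are eventually bounded and their
    \<open>x\<close>-difference is close to \<open>c\<close>.\<close>
  have ev_c: "\<exists>M. \<forall>\<^sub>F k in sequentially. \<exists>p q. y1 k + t k *\<^sub>R p \<in> epi f \<and> y2 k + t k *\<^sub>R q \<in> epi g \<and>
      norm p \<le> M \<and> norm q \<le> M \<and> norm (fst p - fst q - c) \<le> \<epsilon>" for c
  proof -
    obtain a \<alpha> b \<beta> where ab: "(a, \<alpha>) \<in> tangent_inf (epi f)" "(b, \<beta>) \<in> tangent_inf (epi g)"
        "c = a - b"
      using fst_tangent_inf_diff_eq_UNIV[OF conv qc] .
    obtain p where p: "p \<longlonglongrightarrow> (a, \<alpha>)" "\<forall>\<^sub>F k in sequentially. y1 k + t k *\<^sub>R p k \<in> epi f"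
      using tangent_infD[OF ab(1) y1 t] .
    obtain q where q: "q \<longlonglongrightarrow> (b, \<beta>)" "\<forall>\<^sub>F k in sequentially. y2 k + t k *\<^sub>R q k \<in> epi g"
      using tangent_infD[OF ab(2) y2 t] .
    define M where "M = max (norm (a, \<alpha>)) (norm (b, \<beta>)) + 1"
    have "\<forall>\<^sub>F k in sequentially. norm (p k) < M" "\<forall>\<^sub>F k in sequentially. norm (q k) < M"
      by (rule order_tendstoD[OF tendsto_norm[OF p(1)]] order_tendstoD[OF tendsto_norm[OF q(1)]],
          simp add: M_def)+
    moreover have "(\<lambda>k. norm (fst (p k) - fst (q k) - c)) \<longlonglongrightarrow> norm (fst (a, \<alpha>) - fst (b, \<beta>) - c)"
      by (intro tendsto_intros p q)
    then have "\<forall>\<^sub>F k in sequentially. norm (fst (p k) - fst (q k) - c) < \<epsilon>"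
      by (rule order_tendstoD) (simp add: ab(3) \<epsilon>)
    ultimately have "\<forall>\<^sub>F k in sequentially. \<exists>p q. y1 k + t k *\<^sub>R p \<in> epi f \<and> y2 k + t k *\<^sub>R q \<in> epi g \<and>
      norm p \<le> M \<and> norm q \<le> M \<and> norm (fst p - fst q - c) \<le> \<epsilon>"
      using p(2) q(2) by eventually_elim (metis less_imp_le)
    then show ?thesis ..
  qed
  from choice[OF allI[OF this]] obtain M' where M': "\<forall>c. \<forall>\<^sub>F k in sequentially.
      \<exists>p q. y1 k + t k *\<^sub>R p \<in> epi f \<and> y2 k + t k *\<^sub>R q \<in> epi g \<and>
        norm p \<le> M' c \<and> norm q \<le> M' c \<and> norm (fst p - fst q - c) \<le> \<epsilon>" ..
  \<comment> \<open>Only the finitely many signed basis vectors matter, so one bound independent of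
    \<open>k\<close> suffices.\<close>
  define M where "M = Max (M' ` C)"
  have M: "M' c \<le> M" if "c \<in> C" for c
    using that \<open>finite C\<close> by (simp add: M_def)
  define P where "P k = {p. y1 k + t k *\<^sub>R p \<in> epi f \<and> norm p \<le> M}" for k
  define Q where "Q k = {q. y2 k + t k *\<^sub>R q \<in> epi g \<and> norm q \<le> M}" for k
  have convex_PQ: "convex (P k)" "convex (Q k)" for k
    unfolding P_def Q_def by (intro convex_bounded_steps convex_epi conv)+
  \<comment> \<open>The \<open>x\<close>-differences that bounded admissible directions can realise.
    Eventually they fill a ball whose radius does not depend on \<open>k\<close>.\<close>
  define S where "S k = (\<lambda>(p, q). fst p - fst q) ` (P k \<times> Q k)" for k
  have convex_S: "convex (S k)" for k
    unfolding S_def by (intro convex_linear_image convex_Times convex_PQ)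
      (auto intro!: linearI simp: algebra_simps)
  have "\<forall>\<^sub>F k in sequentially. \<forall>c\<in>C. \<exists>x\<in>S k. norm (x - c) \<le> \<epsilon>"
  proof (intro eventually_ball_finite \<open>finite C\<close> ballI)
    fix c assume c: "c \<in> C"
    show "\<forall>\<^sub>F k in sequentially. \<exists>x\<in>S k. norm (x - c) \<le> \<epsilon>"
      using spec[OF M', of c]
    proof eventually_elim
      case (elim k)
      then obtain p q where pq: "y1 k + t k *\<^sub>R p \<in> epi f" "y2 k + t k *\<^sub>R q \<in> epi g"
        "norm p \<le> M' c" "norm q \<le> M' c" "norm (fst p - fst q - c) \<le> \<epsilon>" by (elim exE conjE)
      then have "(p, q) \<in> P k \<times> Q k" using M[OF c] by (simp add: P_def Q_def)
      then have "fst p - fst q \<in> S k" unfolding S_def by (rule rev_image_eqI) simp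
      with pq(5) show ?case by blast
    qed
  qed
  then have ball: "\<forall>\<^sub>F k in sequentially. cball 0 \<epsilon> \<subseteq> S k"
    unfolding C_def
    by eventually_elim (rule cball_subset_convex_near_signed_Basis[OF convex_S \<epsilon>(2)], rule bspec)

  define e where "e k = fst (v1 k) - fst (v2 k)" for k
  \<comment> \<open>The weight of the correction: it vanishes with the mismatch \<open>e k\<close>,
    yet a difference of norm at most \<open>\<epsilon>\<close> is enough to cancel that
    mismatch.\<close>
  define l where "l k = norm (e k) / \<epsilon>" for k
  have "(\<lambda>k. fst (v1 k) - fst (v2 k)) \<longlonglongrightarrow> fst (w, \<rho>1) - fst (w, \<rho>2)"
    by (intro tendsto_intros v1 v2)
  then have "e \<longlonglongrightarrow> 0" by (simp add: e_def[abs_def])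
  then have l0: "l \<longlonglongrightarrow> 0"
    unfolding l_def[abs_def] by (auto intro: tendsto_divide_zero tendsto_norm_zero)
  then have l1: "\<forall>\<^sub>F k in sequentially. l k < 1" by (rule order_tendstoD) simp
  have "\<forall>\<^sub>F k in sequentially. \<exists>pq. fst pq \<in> P k \<and> snd pq \<in> Q k \<and>
      (1 - l k) *\<^sub>R e k + l k *\<^sub>R (fst (fst pq) - fst (snd pq)) = 0"
    using ball l1
  proof eventually_elim
    case (elim k)
    \<comment> \<open>The solution \<open>d\<close> of
      \<open>(1 - l k) *\<^sub>R e k + l k *\<^sub>R d = 0\<close>, written with \<open>sgn\<close>
      to avoid dividing by \<open>l k\<close>; for \<open>e k = 0\<close> it is 0.\<close>
    let ?d = "- ((1 - l k) * \<epsilon>) *\<^sub>R sgn (e k)"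
    have l: "0 \<le> l k" using \<epsilon> by (simp add: l_def)
    have "norm ?d \<le> \<epsilon>"
      using l elim(2) \<epsilon>(1) by (auto simp: norm_sgn abs_mult mult_left_le_one_le)
    then have "?d \<in> S k" using elim(1) by auto
    then obtain p q where pq: "p \<in> P k" "q \<in> Q k" "?d = fst p - fst q" by (auto simp: S_def)
    have "l k *\<^sub>R (fst p - fst q) = l k *\<^sub>R ?d" unfolding pq(3) ..
    also have "\<dots> = - ((1 - l k) *\<^sub>R ((l k * \<epsilon>) *\<^sub>R sgn (e k)))"
      by (simp only: scaleR_scaleR mult_minus_left mult_minus_right scaleR_minus_left scaleR_minus_right ac_simps)
    also have "l k * \<epsilon> = norm (e k)" using \<epsilon>(1) by (simp add: l_def)
    also have "norm (e k) *\<^sub>R sgn (e k) = e k" by (cases "e k = 0") (simp_all add: sgn_div_norm)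
    finally have "(1 - l k) *\<^sub>R e k + l k *\<^sub>R (fst p - fst q) = 0"
      by (simp only: add.right_inverse)
    with pq(1,2) show ?case by (intro exI[of _ "(p, q)"]) simp
  qed
  then obtain pq where "\<forall>\<^sub>F k in sequentially. fst (pq k) \<in> P k \<and> snd (pq k) \<in> Q k \<and>
      (1 - l k) *\<^sub>R e k + l k *\<^sub>R (fst (fst (pq k)) - fst (snd (pq k))) = 0"
    unfolding eventually_ex by blast
  moreover define p q where "p k = fst (pq k)" and "q k = snd (pq k)" for k
  ultimately have pq: "\<forall>\<^sub>F k in sequentially. p k \<in> P k \<and> q k \<in> Q k \<and>
      (1 - l k) *\<^sub>R e k + l k *\<^sub>R (fst (p k) - fst (q k)) = 0"
    by simp
  have lp: "(\<lambda>k. l k *\<^sub>R p k) \<longlonglongrightarrow> 0"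
    by (rule lim_null_scaleR_bounded[OF l0, where B = M])
      (use pq in \<open>auto elim!: eventually_mono simp: P_def\<close>)
  have lq: "(\<lambda>k. l k *\<^sub>R q k) \<longlonglongrightarrow> 0"
    by (rule lim_null_scaleR_bounded[OF l0, where B = M])
      (use pq in \<open>auto elim!: eventually_mono simp: Q_def\<close>)
  define m1 where "m1 k = (1 - l k) *\<^sub>R v1 k + l k *\<^sub>R p k" for k
  define m2 where "m2 k = (1 - l k) *\<^sub>R v2 k + l k *\<^sub>R q k" for k
  have "m1 \<longlonglongrightarrow> (1 - 0) *\<^sub>R (w, \<rho>1) + 0"
    unfolding m1_def[abs_def] by (intro tendsto_intros l0 lp v1)
  then have m1: "m1 \<longlonglongrightarrow> (w, \<rho>1)" by simp
  have "m2 \<longlonglongrightarrow> (1 - 0) *\<^sub>R (w, \<rho>2) + 0"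
    unfolding m2_def[abs_def] by (intro tendsto_intros l0 lq v2)
  then have m2: "m2 \<longlonglongrightarrow> (w, \<rho>2)" by simp
  have "(\<lambda>k. (fst (m1 k), snd (m1 k) + snd (m2 k))) \<longlonglongrightarrow> (fst (w, \<rho>1), snd (w, \<rho>1) + snd (w, \<rho>2))"
    by (intro tendsto_intros m1 m2)
  moreover have "\<forall>\<^sub>F k in sequentially. z k + t k *\<^sub>R (fst (m1 k), snd (m1 k) + snd (m2 k)) \<in> epi (\<lambda>x. f x + g x)"
    using pq l1 v1(2) v2(2)
  proof eventually_elim
    case (elim k)
    have l: "0 \<le> l k" using \<epsilon> by (simp add: l_def)
    have 1: "y1 k + t k *\<^sub>R m1 k \<in> epi f" unfolding m1_def
      by (rule convex_step[OF convex_epi[OF conv(1)]]) (use elim l in \<open>auto simp: P_def\<close>)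
    have 2: "y2 k + t k *\<^sub>R m2 k \<in> epi g" unfolding m2_def
      by (rule convex_step[OF convex_epi[OF conv(2)]]) (use elim l in \<open>auto simp: Q_def\<close>)
    \<comment> \<open>The corrected directions have exactly equal \<open>x\<close>-parts, so both
      steps end over the same point and the heights can be added.\<close>
    have "fst (m1 k) - fst (m2 k) = (1 - l k) *\<^sub>R e k + l k *\<^sub>R (fst (p k) - fst (q k))"
      by (simp add: m1_def m2_def e_def algebra_simps)
    then have "fst (m2 k) = fst (m1 k)" using elim(1) by simp
    then have "(fst (z k) + t k *\<^sub>R fst (m1 k), s k + t k * snd (m1 k)) \<in> epi f"
      "(fst (z k) + t k *\<^sub>R fst (m1 k), snd (z k) - s k + t k * snd (m2 k)) \<in> epi g"
      using 1 2 by (auto simp: y1_def y2_def plus_prod_def scaleR_prod_def)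
    from epi_add[OF this] show ?case
      by (simp add: plus_prod_def scaleR_prod_def algebra_simps)
  qed
  ultimately show "\<exists>v'. v' \<longlonglongrightarrow> (w, \<rho>1 + \<rho>2) \<and>
      (\<forall>\<^sub>F k in sequentially. z k + t k *\<^sub>R v' k \<in> epi (\<lambda>x. f x + g x))"
    by auto
qed

section \<open>Splitting a subgradient at infinity of the sum\<close>

lemma subdiff_inf_add_subset:
  fixes f g :: "'a::euclidean_space \<Rightarrow> ereal"
  assumes conv: "convex_fun f" "convex_fun g" and inf: "\<And>x. f x \<noteq> -\<infinity>" "\<And>x. g x \<noteq> -\<infinity>"
    and qc: "singular_subdiff_inf f \<inter> uminus ` singular_subdiff_inf g \<subseteq> {0}"
  shows "subdiff_inf (\<lambda>x. f x + g x) \<subseteq> subdiff_inf f + subdiff_inf g"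
proof
  fix u assume u: "u \<in> subdiff_inf (\<lambda>x. f x + g x)"
  let ?T = "tangent_inf (epi f) \<times> tangent_inf (epi g)"
  let ?L = "\<lambda>(v, w). (fst v - fst w, snd v + snd w - u \<bullet> fst w)"
  have lin: "linear ?L"
    by (auto intro!: linearI simp: algebra_simps)
  \<comment> \<open>First component 0 means a common \<open>x\<close>-part \<open>w\<close>. Then
    the heights add up to a tangent of the sum, for which \<open>u\<close> makes the second
    component nonnegative.\<close>
  have "(0, -1) \<notin> ?L ` ?T"
  proof
    assume "(0, -1) \<in> ?L ` ?T"
    then obtain w \<rho>1 \<rho>2 where "(w, \<rho>1) \<in> tangent_inf (epi f)" "(w, \<rho>2) \<in> tangent_inf (epi g)"
        "\<rho>1 + \<rho>2 - u \<bullet> w = -1" by auto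
    then show False
      using u tangent_inf_epi_add[OF conv inf qc, of w \<rho>1 \<rho>2]
      by (fastforce simp: subdiff_inf_def normal_inf_def)
  qed
  then obtain pc where pc: "pc \<noteq> 0" "pc \<bullet> (0, -1) \<le> 0" "\<forall>x\<in>?T. 0 \<le> pc \<bullet> ?L x"
    by (rule convex_cone_image_separation
        [OF lin convex_cone_Times[OF conv[THEN convex_cone_tangent_inf_epi]]]) blast
  obtain p c where pc_eq: "pc = (p, c)" by fastforce
  have sep: "0 \<le> p \<bullet> (w1 - w2) + c * (\<rho>1 + \<rho>2 - u \<bullet> w2)"
    if "(w1, \<rho>1) \<in> tangent_inf (epi f)" "(w2, \<rho>2) \<in> tangent_inf (epi g)" for w1 w2 \<rho>1 \<rho>2
    using that bspec[OF pc(3), of "((w1, \<rho>1), (w2, \<rho>2))"] by (simp add: pc_eq)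
  \<comment> \<open>For \<open>c = 0\<close> the functional would be nonnegative on all differences
    of tangent \<open>x\<close>-parts; these include \<open>- p\<close>, which forces
    \<open>p = 0\<close>.\<close>
  have "c \<noteq> 0"
  proof
    assume c: "c = 0"
    obtain w1 \<rho>1 w2 \<rho>2 where "(w1, \<rho>1) \<in> tangent_inf (epi f)" "(w2, \<rho>2) \<in> tangent_inf (epi g)"
        "- p = w1 - w2"
      using fst_tangent_inf_diff_eq_UNIV[OF conv qc] .
    then have "0 \<le> p \<bullet> (- p)" using sep c by fastforce
    then have "p = 0" using inner_ge_zero[of p] by simp
    then show False using pc(1) c by (simp add: pc_eq zero_prod_def)
  qed
  then have c: "c > 0" using pc(2) by (simp add: pc_eq)
  \<comment> \<open>Dividing \<open>sep\<close> by \<open>c\<close> and setting the tangent of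
    \<open>g\<close> to 0 leaves the inequality for \<open>u1\<close>; setting the tangent of
    \<open>f\<close> to 0 leaves the one for \<open>u - u1\<close>.\<close>
  define u1 where "u1 = - (p /\<^sub>R c)"
  have z: "(0, 0) \<in> tangent_inf \<Omega>" for \<Omega> :: "('a \<times> real) set"
    using zero_in_tangent_inf[of \<Omega>] by (simp add: zero_prod_def)
  have "u1 \<bullet> w \<le> \<rho>" if "(w, \<rho>) \<in> tangent_inf (epi f)" for w \<rho>
    using sep[OF that z] c by (simp add: u1_def field_simps)
  then have "u1 \<in> subdiff_inf f" by (auto simp: subdiff_inf_def normal_inf_def)
  moreover have "(u - u1) \<bullet> w \<le> \<rho>" if "(w, \<rho>) \<in> tangent_inf (epi g)" for w \<rho>
    using sep[OF z that] c by (simp add: u1_def inner_add_left field_simps)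
  then have "u - u1 \<in> subdiff_inf g" by (auto simp: subdiff_inf_def normal_inf_def)
  ultimately show "u \<in> subdiff_inf f + subdiff_inf g"
    using set_plus_intro[of u1 _ "u - u1"] by fastforce
qed

theorem proposition4p18:
  fixes f g h :: "real ^ 'n \<Rightarrow> ereal"
  assumes "\<And>x. f x \<noteq> -\<infinity>" and "proper_fun f" and "lsc_fun f" and "convex_fun f"
    and "\<And>x. g x \<noteq> -\<infinity>" and "proper_fun g" and "lsc_fun g" and "convex_fun g"
    and "h = (\<lambda>x. f x + g x)"
    and "\<not> bounded (domain_of h)"
    and "singular_subdiff_inf f \<inter> uminus ` singular_subdiff_inf g = {0}"
  shows "subdiff_inf h \<subseteq> subdiff_inf f + subdiff_inf g"
  unfolding \<open>h = _\<close> by (rule subdiff_inf_add_subset) (use assms in auto)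

end
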